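(* Let $\mathbf{A}=[a_{i,j}]\in\mathbb{R}^{n_x\times n_x}$ and let $\mathbf{C}\in\mathbb{R}^{n_y\times n_x}$ have columns $\mathbf{C}_1,\dots,\mathbf{C}_{n_x}$. Consider the homogeneous linear time-invariant system with exact measurements $$\dot{\mathbf{x}}(t)=\mathbf{A}\mathbf{x}(t)\ \text{ for a.e. } t\ge t_0,\qquad \mathbf{y}(t)=\mathbf{C}\mathbf{x}(t)\ \text{ for all } t\ge t_0,$$ with $\mathbf{x}(t_0)\in X_0$, where $X_0\subset\mathbb{R}^{n_x}$ is a nonempty compact interval. Let $\mathbf{L}\in\mathbb{R}^{n_x\times n_y}$ be any matrix, with rows $\boldsymbol{\ell}_i^{\mathrm T}$, satisfying $$a_{i,i}-\boldsymbol{\ell}_i^{\mathrm T}\mathbf{C}_i+\sum_{j\ne i}\left|a_{i,j}-\boldsymbol{\ell}_i^{\mathrm T}\mathbf{C}_j\right|<0\quad\text{for all } i\in\{1,\dots,n_x\}.$$ Then the interval state estimate $[\mathbf{x}^L,\mathbf{x}^U]$ produced by the No Constraints method (defined in the context) with gain matrix $\mathbf{L}$ and with the natural interval extension as the inclusion monotonic interval extension is asymptotically exact, i.e. $$\mathbf{x}^U(t)-\mathbf{x}^L(t)\to\mathbf{0}\quad\text{as } t\to+\infty.$$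
   Context: Inequalities between vectors are componentwise, and $[\mathbf{v},\mathbf{w}]=\{\mathbf{z}:\mathbf{v}\le\mathbf{z}\le\mathbf{w}\}$. Faces. For $\mathbf{v},\mathbf{w}\in\mathbb{R}^{n_x}$, put $\hat v_j=\min\{v_j,(v_j+w_j)/2\}$, $\hat w_j=\max\{w_j,(v_j+w_j)/2\}$, and for each $i\in\{1,\dots,n_x\}$ define the intervals $B_i^L(\mathbf{v},\mathbf{w})=\{\mathbf{z}\in[\hat{\mathbf{v}},\hat{\mathbf{w}}]:z_i=\hat v_i\}$ and $B_i^U(\mathbf{v},\mathbf{w})=\{\mathbf{z}\in[\hat{\mathbf{v}},\hat{\mathbf{w}}]:z_i=\hat w_i\}$. Natural interval extension of a linear function. For $g(\mathbf{z})=\mathbf{a}^{\mathrm T}\mathbf{z}$ and an interval $Z=[\mathbf{z}^L,\mathbf{z}^U]$, the natural interval extension is $[g^L(Z),g^U(Z)]=[\sum_j v_j^L,\sum_j v_j^U]$, where $[v_j^L,v_j^U]=[a_jz_j^L,a_jz_j^U]$ if $a_j\ge0$ and $[v_j^L,v_j^U]=[a_jz_j^U,a_jz_j^L]$ otherwise. No Constraints method (for this linear system with zero measurement noise and no disturbance). Let $\hat{\mathbf{f}}(\mathbf{z};\mathbf{L})=(\mathbf{A}-\mathbf{L}\mathbf{C})\mathbf{z}$, and let $\hat f_i^L(Z;\mathbf{L})$, $\hat f_i^U(Z;\mathbf{L})$ be the lower and upper endpoints of the natural interval extension on the interval $Z$ of the $i$-th component $\mathbf{z}\mapsto\mathbf{m}_i^{\mathrm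 T}\mathbf{z}$, where $\mathbf{m}_i^{\mathrm T}$ is the $i$-th row of $\mathbf{A}-\mathbf{L}\mathbf{C}$. The estimate $[\mathbf{x}^L,\mathbf{x}^U]$ is given by absolutely continuous functions $\mathbf{x}^L,\mathbf{x}^U$ on $[t_0,+\infty)$ with $[\mathbf{x}^L(t_0),\mathbf{x}^U(t_0)]=X_0$ and, for each $i$ and almost every $t\ge t_0$, $$\dot x_i^L(t)=\hat f_i^L\big(B_i^L(\mathbf{x}^L(t),\mathbf{x}^U(t));\mathbf{L}\big)+(\mathbf{L}\mathbf{y}(t))_i,\qquad \dot x_i^U(t)=\hat f_i^U\big(B_i^U(\mathbf{x}^L(t),\mathbf{x}^U(t));\mathbf{L}\big)+(\mathbf{L}\mathbf{y}(t))_i.$$ *)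

theory Defs
  imports "HOL-Analysis.Analysis"
begin

text \<open>Points of the state space are vectors of type \<^typ>\<open>real^'n\<close>, whose library order is
  componentwise, so that the library interval \<open>{v..w}\<close> is the box of all \<open>z\<close> with \<open>v \<le> z \<le> w\<close>.\<close>

subsection \<open>Absolute continuity\<close>

text \<open>The elements of \<open>D\<close> are the endpoint pairs of finitely many pairwise non-overlapping
  subintervals of \<open>[a, b]\<close>. (The library constant \<^const>\<open>absolutely_continuous\<close> is about measures.)\<close>

definition abs_cont_on_Icc :: "(real \<Rightarrow> 'a::metric_space) \<Rightarrow> real \<Rightarrow> real \<Rightarrow> bool" where
  "abs_cont_on_Icc f a b \<longleftrightarrow>
    (\<forall>\<epsilon>>0. \<exists>\<delta>>0. \<forall>D :: (real \<times> real) set.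
      finite D \<longrightarrow>
      (\<forall>(c, d)\<in>D. a \<le> c \<and> c \<le> d \<and> d \<le> b) \<longrightarrow>
      disjoint_family_on (\<lambda>(c, d). {c<..<d}) D \<longrightarrow>
      (\<Sum>(c, d)\<in>D. d - c) < \<delta> \<longrightarrow>
      (\<Sum>(c, d)\<in>D. dist (f c) (f d)) < \<epsilon>)"

text \<open>On the unbounded interval \<open>[t\<^sub>0, \<infinity>)\<close>, absolute continuity means absolute continuity on
  every compact subinterval, as usual for solutions of differential equations.\<close>

definition abs_cont_on_from :: "(real \<Rightarrow> 'a::metric_space) \<Rightarrow> real \<Rightarrow> bool" where
  "abs_cont_on_from f t0 \<longleftrightarrow> (\<forall>T\<ge>t0. abs_cont_on_Icc f t0 T)"

subsection \<open>Faces\<close>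

definition hat_lower :: "real^'n \<Rightarrow> real^'n \<Rightarrow> real^'n" where
  "hat_lower v w = (\<chi> j. min (v $ j) ((v $ j + w $ j) / 2))"

definition hat_upper :: "real^'n \<Rightarrow> real^'n \<Rightarrow> real^'n" where
  "hat_upper v w = (\<chi> j. max (w $ j) ((v $ j + w $ j) / 2))"

definition face_lower :: "'n \<Rightarrow> real^'n \<Rightarrow> real^'n \<Rightarrow> (real^'n) set" where
  "face_lower i v w = {z \<in> {hat_lower v w..hat_upper v w}. z $ i = hat_lower v w $ i}"

definition face_upper :: "'n \<Rightarrow> real^'n \<Rightarrow> real^'n \<Rightarrow> (real^'n) set" where
  "face_upper i v w = {z \<in> {hat_lower v w..hat_upper v w}. z $ i = hat_upper v w $ i}"

subsection \<open>Natural interval extension of a linear function\<close>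

text \<open>For a nonempty interval \<open>Z = {zL..zU}\<close>, the endpoints are recovered as
  \<open>zL = Inf Z\<close> and \<open>zU = Sup Z\<close>.\<close>

definition natext_lower :: "real^'n \<Rightarrow> (real^'n) set \<Rightarrow> real" where
  "natext_lower a Z = (\<Sum>j\<in>UNIV. if a $ j \<ge> 0 then a $ j * Inf Z $ j else a $ j * Sup Z $ j)"

definition natext_upper :: "real^'n \<Rightarrow> (real^'n) set \<Rightarrow> real" where
  "natext_upper a Z = (\<Sum>j\<in>UNIV. if a $ j \<ge> 0 then a $ j * Sup Z $ j else a $ j * Inf Z $ j)"

lemma natext_Icc:
  fixes zL zU :: "real^'n"
  assumes "zL \<le> zU"
  shows "natext_lower a {zL..zU} = (\<Sum>j\<in>UNIV. if a $ j \<ge> 0 then a $ j * zL $ j else a $ j * zU $ j)"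
    and "natext_upper a {zL..zU} = (\<Sum>j\<in>UNIV. if a $ j \<ge> 0 then a $ j * zU $ j else a $ j * zL $ j)"
  by (simp_all only: natext_lower_def natext_upper_def
      cInf_atLeastAtMost[OF assms] cSup_atLeastAtMost[OF assms])

lemma hat_lower_le_hat_upper: "hat_lower v w \<le> hat_upper v w"
  by (auto simp: less_eq_vec_def hat_lower_def hat_upper_def)

lemma face_lower_eq_Icc:
  "face_lower i v w =
    {hat_lower v w..(\<chi> j. if j = i then hat_lower v w $ i else hat_upper v w $ j)}"
  using hat_lower_le_hat_upper[of v w]
  by (auto simp: face_lower_def less_eq_vec_def intro: antisym split: if_splits)
     (metis antisym order_trans)+

lemma face_upper_eq_Icc:
  "face_upper i v w =
    {(\<chi> j. if j = i then hat_upper v w $ i else hat_lower v w $ j)..hat_upper v w}"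
  using hat_lower_le_hat_upper[of v w]
  by (auto simp: face_upper_def less_eq_vec_def intro: antisym split: if_splits)
     (metis antisym order_trans)+

subsection \<open>The system and the No Constraints estimate\<close>

definition lti_solution ::
    "real^'n^'n \<Rightarrow> real^'n^'m \<Rightarrow> real \<Rightarrow> (real^'n) set \<Rightarrow>
     (real \<Rightarrow> real^'n) \<Rightarrow> (real \<Rightarrow> real^'m) \<Rightarrow> bool" where
  "lti_solution A C t0 X0 x y \<longleftrightarrow>
    abs_cont_on_from x t0 \<and>
    (AE t\<in>{t0..} in lebesgue. (x has_vector_derivative A *v x t) (at t within {t0..})) \<and>
    (\<forall>t\<ge>t0. y t = C *v x t) \<and>
    x t0 \<in> X0"

definition fhat_lower ::
    "real^'n^'n \<Rightarrow> real^'n^'m \<Rightarrow> real^'m^'n \<Rightarrow> 'n \<Rightarrow> (real^'n) set \<Rightarrow> real" where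
  "fhat_lower A C L i Z = natext_lower (row i (A - L ** C)) Z"

definition fhat_upper ::
    "real^'n^'n \<Rightarrow> real^'n^'m \<Rightarrow> real^'m^'n \<Rightarrow> 'n \<Rightarrow> (real^'n) set \<Rightarrow> real" where
  "fhat_upper A C L i Z = natext_upper (row i (A - L ** C)) Z"

definition no_constraints_estimate ::
    "real^'n^'n \<Rightarrow> real^'n^'m \<Rightarrow> real^'m^'n \<Rightarrow> real \<Rightarrow> (real^'n) set \<Rightarrow>
     (real \<Rightarrow> real^'m) \<Rightarrow> (real \<Rightarrow> real^'n) \<Rightarrow> (real \<Rightarrow> real^'n) \<Rightarrow> bool" where
  "no_constraints_estimate A C L t0 X0 y xL xU \<longleftrightarrow>
    abs_cont_on_from xL t0 \<and> abs_cont_on_from xU t0 \<and>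
    {xL t0..xU t0} = X0 \<and>
    (\<forall>i. AE t\<in>{t0..} in lebesgue.
      ((\<lambda>s. xL s $ i) has_real_derivative
        fhat_lower A C L i (face_lower i (xL t) (xU t)) + (L *v y t) $ i) (at t within {t0..})) \<and>
    (\<forall>i. AE t\<in>{t0..} in lebesgue.
      ((\<lambda>s. xU s $ i) has_real_derivative
        fhat_upper A C L i (face_upper i (xL t) (xU t)) + (L *v y t) $ i) (at t within {t0..}))"

end

theory Submission
  imports Defs
begin

text \<open>
  Write \<open>M = A - L C\<close> and let \<open>\<delta> = xU - xL\<close> be the width of the estimate. The measurement term
  \<open>L y\<close> enters the equations for both bounds and cancels in the difference. On the faces, the
  \<open>j\<close>-th coordinate ranges over an interval of length \<open>max 0 \<delta>\<^sub>j\<close>, except that the \<open>i\<close>-th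
  coordinate is pinned, to the upper end for the upper bound and to the lower end for the lower
  bound. Hence a coefficient \<open>m\<^sub>i\<^sub>j\<close> off the diagonal contributes its absolute value to the growth of
  the width, but the diagonal coefficient contributes its signed value (\<open>natext_faces_diff\<close>):
  \<open>\<delta>\<^sub>i' = m\<^sub>i\<^sub>i max 0 \<delta>\<^sub>i + (\<Sum>j\<noteq>i. \<bar>m\<^sub>i\<^sub>j\<bar> max 0 \<delta>\<^sub>j)\<close>. The gain condition says that
  the coefficients on the right-hand side have a negative sum, and so the width contracts in the
  maximum norm.

  The equation holds a priori for almost every time only. The width is however absolutely
  continuous and the right-hand side is a continuous function of it, so integrating
  (\<open>fundamental_theorem_of_calculus_abs_cont\<close>) and differentiating again gives the equation at
  every time (\<open>no_constraints_width_deriv\<close>). Classical comparison then applies: by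
  \<open>first_contact\<close> the width can neither become negative nor catch up with an exponentially
  decaying barrier \<open>K exp (- c (t - t0))\<close>, where \<open>- c\<close> lies strictly above all the coefficient sums.
\<close>

section \<open>Absolutely continuous functions and the fundamental theorem of calculus\<close>

text \<open>Absolute continuity in the language of gauge integration. Replacing tagged cells by
  their endpoint pairs loses nothing: two nondegenerate cells with the same endpoints would
  overlap, and a degenerate cell determines its tag.\<close>

lemma abs_cont_tagged_partial_division:
  fixes f :: "real \<Rightarrow> 'a::real_normed_vector"
  assumes ac: "abs_cont_on_Icc f a b" and "e > 0"
  obtains \<delta> where "\<delta> > 0"
    and "\<And>q. q tagged_partial_division_of {a..b} \<Longrightarrow> (\<Sum>(x, K)\<in>q. measure lborel K) < \<delta> \<Longrightarrow>
           (\<Sum>(x, K)\<in>q. norm (f (Sup K) - f (Inf K))) < e"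
proof -
  obtain \<delta> where "\<delta> > 0" and \<delta>: "\<forall>D. finite D \<longrightarrow>
      (\<forall>(c, d)\<in>D. a \<le> c \<and> c \<le> d \<and> d \<le> b) \<longrightarrow>
      disjoint_family_on (\<lambda>(c, d). {c<..<d}) D \<longrightarrow> (\<Sum>(c, d)\<in>D. d - c) < \<delta> \<longrightarrow>
      (\<Sum>(c, d)\<in>D. dist (f c) (f d)) < e"
    using ac \<open>e > 0\<close> unfolding abs_cont_on_Icc_def by blast
  show thesis
  proof
    show "\<delta> > 0" by fact
    fix q
    assume q: "q tagged_partial_division_of {a..b}" and small: "(\<Sum>(x, K)\<in>q. measure lborel K) < \<delta>"
    have fin: "finite q"
      using q by (simp add: tagged_partial_division_of_def)
    have cell: "\<exists>c d. K = {c..d} \<and> c \<le> d \<and> a \<le> c \<and> d \<le> b \<and> c \<le> x \<and> x \<le> d"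
      if xK: "(x, K) \<in> q" for x K
    proof -
      obtain c d where "K = cbox c d" "x \<in> K" "K \<subseteq> {a..b}"
        using tagged_partial_division_ofD(2-4)[OF q xK] by blast
      then show ?thesis
        by (intro exI[of _ c] exI[of _ d]) (auto simp: subset_iff)
    qed
    define h :: "real \<times> real set \<Rightarrow> real \<times> real" where "h = (\<lambda>(x, K). (Inf K, Sup K))"
    have disj: "{Inf K<..<Sup K} \<inter> {Inf K'<..<Sup K'} = {}"
      if "(x, K) \<in> q" "(x', K') \<in> q" "(x, K) \<noteq> (x', K')" for x K x' K'
      using tagged_partial_division_ofD(5)[OF q that] cell[OF that(1)] cell[OF that(2)]
      by (auto simp: interior_atLeastAtMost_real)
    have inj: "inj_on h q"
    proof (rule inj_onI, clarify)
      fix x K x' K'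
      assume *: "(x, K) \<in> q" "(x', K') \<in> q" and eq: "h (x, K) = h (x', K')"
      obtain c d where K: "K = {c..d}" "c \<le> d" "c \<le> x" "x \<le> d" using cell[OF *(1)] by blast
      obtain c' d' where K': "K' = {c'..d'}" "c' \<le> d'" "c' \<le> x'" "x' \<le> d'"
        using cell[OF *(2)] by blast
      have cd: "c' = c" "d' = d" using eq K K' by (auto simp: h_def)
      show "x = x' \<and> K = K'"
      proof (cases "c = d")
        case True
        then show ?thesis using K K' cd by auto
      next
        case False
        then have "{c<..<d} \<noteq> {}" using K by auto
        then show ?thesis using disj[OF *] K K' cd by auto
      qed
    qed
    have "(\<Sum>(c, d)\<in>h ` q. dist (f c) (f d)) < e"
    proof (rule \<delta>[THEN spec, THEN mp, THEN mp, THEN mp, THEN mp])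
      show "finite (h ` q)" using fin by simp
      show "\<forall>(c, d)\<in>h ` q. a \<le> c \<and> c \<le> d \<and> d \<le> b"
        using cell by (fastforce simp: h_def)
      show "disjoint_family_on (\<lambda>(c, d). {c<..<d}) (h ` q)"
        unfolding disjoint_family_on_def using disj by (fastforce simp: h_def)
      have "(\<Sum>(c, d)\<in>h ` q. d - c) = (\<Sum>(x, K)\<in>q. measure lborel K)"
        unfolding sum.reindex[OF inj] using cell by (intro sum.cong) (fastforce simp: h_def)+
      then show "(\<Sum>(c, d)\<in>h ` q. d - c) < \<delta>" using small by simp
    qed
    also have "(\<Sum>(c, d)\<in>h ` q. dist (f c) (f d)) = (\<Sum>(x, K)\<in>q. norm (f (Sup K) - f (Inf K)))"
      unfolding sum.reindex[OF inj]
      by (intro sum.cong) (auto simp: h_def dist_norm norm_minus_commute)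
    finally show "(\<Sum>(x, K)\<in>q. norm (f (Sup K) - f (Inf K))) < e" .
  qed
qed

lemma tagged_partial_division_content_le:
  fixes q :: "('a::euclidean_space \<times> 'a set) set"
  assumes q: "q tagged_partial_division_of S" and T: "T \<in> lmeasurable"
    and sub: "\<And>x K. (x, K) \<in> q \<Longrightarrow> K \<subseteq> T"
  shows "(\<Sum>(x, K)\<in>q. measure lborel K) \<le> measure lebesgue T"
proof -
  have tag: "q tagged_division_of \<Union>(snd ` q)"
    using q by (rule tagged_partial_division_of_Union_self)
  then have div: "snd ` q division_of \<Union>(snd ` q)"
    by (rule division_of_tagged_division)
  have "(\<Sum>(x, K)\<in>q. measure lborel K) = sum (measure lborel) (snd ` q)"
    by (rule sum.over_tagged_division_lemma[OF tag]) (simp add: content_eq_0_interior)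
  also have "\<dots> = (\<Sum>K\<in>snd ` q. measure lebesgue K)"
    using division_ofD(4)[OF div] by (intro sum.cong refl) fastforce
  also have "\<dots> = measure lebesgue (\<Union>(snd ` q))"
    by (rule content_division[OF div])
  also have "\<dots> \<le> measure lebesgue T"
  proof (rule measure_mono_fmeasurable)
    show "\<Union>(snd ` q) \<subseteq> T" by (auto dest: subsetD[OF sub])
  qed (use lmeasurable_division[OF div] T in auto)
  finally show ?thesis .
qed

text \<open>The Henstock--Kurzweil argument for the fundamental theorem of calculus needs a pointwise
  derivative at the tag of each cell. Cells tagged in the exceptional null set are made harmless
  by choosing a gauge that keeps them inside an open set of small measure: their total length is then
  small, and absolute continuity bounds the variation of \<open>f\<close> over them.\<close>

theorem fundamental_theorem_of_calculus_abs_cont: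
  fixes f :: "real \<Rightarrow> 'a::banach"
  assumes ac: "abs_cont_on_Icc f a b" and "a \<le> b"
    and ae: "AE t\<in>{a..b} in lebesgue. (f has_vector_derivative g t) (at t within {a..b})"
  shows "(g has_integral (f b - f a)) {a..b}"
proof -
  obtain S where S: "S \<in> null_sets lebesgue" and "\<And>t. t \<in> space lebesgue - S \<Longrightarrow>
      t \<in> {a..b} \<longrightarrow> (f has_vector_derivative g t) (at t within {a..b})"
    using AE_E3[OF ae] by blast
  then have der: "(f has_vector_derivative g t) (at t within {a..b})" if "t \<in> {a..b} - S" for t
    using that by simp
  (* Changing the integrand on a null set leaves the integral unchanged; with the value 0 on S,
     cells tagged in S contribute nothing to the Riemann sums, however large g is there. *)
  define g0 where "g0 = (\<lambda>t. if t \<in> S then 0 else g t)"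
  have "(g0 has_integral (f b - f a)) {a..b}"
  proof (cases "a = b")
    case True
    then show ?thesis by auto
  next
    case False
    then have "a < b" using \<open>a \<le> b\<close> by simp
    show ?thesis
      unfolding has_integral_factor_content_real
    proof (intro allI impI)
      fix e :: real
      assume "e > 0"
      (* The error allowed is e * (b - a): one half for the tags in S, one half for the others. *)
      have "e / 2 > 0" "e / 2 * (b - a) > 0" using \<open>e > 0\<close> \<open>a < b\<close> by auto
      obtain \<delta> where "\<delta> > 0"
        and \<delta>: "\<And>q. q tagged_partial_division_of {a..b} \<Longrightarrow> (\<Sum>(x, K)\<in>q. measure lborel K) < \<delta> \<Longrightarrow>
           (\<Sum>(x, K)\<in>q. norm (f (Sup K) - f (Inf K))) < e / 2 * (b - a)"
        by (rule abs_cont_tagged_partial_division[OF ac \<open>e / 2 * (b - a) > 0\<close>]) blast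
      obtain T where T: "open T" "S \<subseteq> T" "T - S \<in> lmeasurable"
        "emeasure lebesgue (T - S) < ennreal \<delta>"
        using sets_lebesgue_outer_open[of S \<delta>] S \<open>\<delta> > 0\<close> by blast
      have Tm: "T \<in> lmeasurable" and Tless: "measure lebesgue T < \<delta>"
      proof -
        have eq: "T = (T - S) \<union> S" using T(2) by auto
        have Sl: "S \<in> lmeasurable" using S by (rule fmeasurableI_null_sets)
        show "T \<in> lmeasurable" by (subst eq) (intro fmeasurable.Un T(3) Sl)
        have "measure lebesgue T = measure lebesgue (T - S)"
          using S by (simp add: measure_Diff_null_set T(1) borel_open)
        also have "\<dots> < \<delta>"
          using T(3,4) \<open>\<delta> > 0\<close> by (simp add: emeasure_eq_measure2 ennreal_less_iff)
        finally show "measure lebesgue T < \<delta>" .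
      qed
      have "\<exists>d>0. t \<in> {a..b} - S \<longrightarrow> (\<forall>y\<in>{a..b}. norm (y - t) < d \<longrightarrow>
            norm (f y - f t - (y - t) *\<^sub>R g t) \<le> e / 2 * norm (y - t))" (is "\<exists>d>0. ?P t d") for t
      proof (cases "t \<in> {a..b} - S")
        case True
        then show ?thesis
          using der[of t] \<open>e / 2 > 0\<close>
          unfolding has_vector_derivative_def has_derivative_within_alt by blast
      next
        case False
        then show ?thesis using zero_less_one by blast
      qed
      then obtain d where d0: "\<And>t. 0 < d t \<and> ?P t (d t)"
        by metis
      then have d: "\<And>t. 0 < d t"
        "\<And>t y. \<lbrakk>t \<in> {a..b} - S; y \<in> {a..b}; norm (y - t) < d t\<rbrakk>
            \<Longrightarrow> norm (f y - f t - (y - t) *\<^sub>R g t) \<le> e / 2 * norm (y - t)"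
        by blast+
      define \<gamma> where "\<gamma> = (\<lambda>t. if t \<in> S then T else ball t (d t))"
      have gauge: "gauge \<gamma>"
        using T d(1) by (auto simp: gauge_def \<gamma>_def)
      have error: "norm ((\<Sum>(x, K)\<in>p. measure lborel K *\<^sub>R g0 x) - (f b - f a)) \<le> e * measure lborel {a..b}"
        if ptag: "p tagged_division_of {a..b}" and fine: "\<gamma> fine p" for p
      proof -
        define err where "err = (\<lambda>(x, K). measure lborel K *\<^sub>R g0 x - (f (Sup K) - f (Inf K)))"
        define q where "q = {(x, K)\<in>p. x \<in> S}"
        have fin: "finite p" using ptag by blast
        have qp: "q \<subseteq> p" by (auto simp: q_def)
        have qtag: "q tagged_partial_division_of {a..b}"
          using ptag qp tagged_partial_division_subset unfolding tagged_division_of_def by blast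
        have bad: "norm (sum err q) \<le> e / 2 * (b - a)"
        proof -
          have "(\<Sum>(x, K)\<in>q. measure lborel K) \<le> measure lebesgue T"
          proof (rule tagged_partial_division_content_le[OF qtag Tm])
            fix x K
            assume "(x, K) \<in> q"
            then have xK: "(x, K) \<in> p" "x \<in> S" by (auto simp: q_def)
            then show "K \<subseteq> T" using fineD[OF fine xK(1)] by (simp add: \<gamma>_def)
          qed
          then have *: "(\<Sum>(x, K)\<in>q. norm (f (Sup K) - f (Inf K))) < e / 2 * (b - a)"
            using Tless by (intro \<delta>[OF qtag]) simp
          have "norm (sum err q) \<le> (\<Sum>(x, K)\<in>q. norm (f (Sup K) - f (Inf K)))"
            by (rule sum_norm_le)
              (auto simp: q_def err_def g0_def norm_minus_commute)
          then show ?thesis using * by linarith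
        qed
        have length: "b - a = (\<Sum>(x, K)\<in>p. Sup K - Inf K)"
          using additive_tagged_division_1[OF \<open>a \<le> b\<close> ptag, of "\<lambda>x. x"] by simp
        have len0: "0 \<le> (case z of (x, K) \<Rightarrow> Sup K - Inf K)" if zp: "z \<in> p" for z
        proof -
          obtain x K where z: "z = (x, K)" by (cases z)
          obtain u v where "K = cbox u v" "x \<in> K"
            using tagged_division_ofD(2,4)[OF ptag] zp z by blast
          then show ?thesis using z by auto
        qed
        have good: "norm (sum err (p - q)) \<le> e / 2 * (b - a)"
        proof -
          have "norm (sum err (p - q)) \<le> (\<Sum>(x, K)\<in>p - q. e / 2 * (Sup K - Inf K))"
          proof (rule sum_norm_le, clarify)
            fix x K
            assume xK: "(x, K) \<in> p" "(x, K) \<notin> q"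
            then have xS: "x \<notin> S" by (auto simp: q_def)
            obtain u v where K: "K = cbox u v" "x \<in> K" "K \<subseteq> {a..b}"
              using tagged_division_ofD(2-4)[OF ptag xK(1)] by blast
            then have uv: "u \<le> x" "x \<le> v" "u \<in> {a..b}" "v \<in> {a..b}" "x \<in> {a..b}" by auto
            have "K \<subseteq> ball x (d x)" using fineD[OF fine xK(1)] xS by (simp add: \<gamma>_def)
            moreover have "u \<in> K" "v \<in> K" using K(1) uv by auto
            ultimately have "u \<in> ball x (d x)" "v \<in> ball x (d x)" by blast+
            then have near: "norm (u - x) < d x" "norm (v - x) < d x"
              by (auto simp: dist_norm norm_minus_commute)
            have "err (x, K) = (f u - f x - (u - x) *\<^sub>R g x) - (f v - f x - (v - x) *\<^sub>R g x)"
              using K uv xS by (simp add: err_def g0_def algebra_simps)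
            also have "norm \<dots> \<le> e / 2 * norm (u - x) + e / 2 * norm (v - x)"
              using near uv xS by (intro order_trans[OF norm_triangle_ineq4 add_mono] d(2)) auto
            also have "\<dots> = e / 2 * (Sup K - Inf K)"
              using K uv by (simp add: field_simps)
            finally show "norm (err (x, K)) \<le> e / 2 * (Sup K - Inf K)" .
          qed
          also have "\<dots> = e / 2 * (\<Sum>(x, K)\<in>p - q. Sup K - Inf K)"
            by (simp add: sum_distrib_left split_def)
          also have "\<dots> \<le> e / 2 * (b - a)"
            unfolding length using \<open>e > 0\<close> fin len0
            by (intro mult_left_mono sum_mono2) auto
          finally show ?thesis .
        qed
        have "(\<Sum>(x, K)\<in>p. measure lborel K *\<^sub>R g0 x) - (f b - f a) = sum err p"
          using additive_tagged_division_1[OF \<open>a \<le> b\<close> ptag, of f]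
          by (simp add: err_def sum_subtractf split_def)
        also have "\<dots> = sum err (p - q) + sum err q"
          using sum.subset_diff[OF qp fin] .
        also have "norm \<dots> \<le> e / 2 * (b - a) + e / 2 * (b - a)"
          using good bad by (rule norm_triangle_mono)
        finally show ?thesis using \<open>a \<le> b\<close> by (simp add: algebra_simps)
      qed
      show "\<exists>\<gamma>. gauge \<gamma> \<and> (\<forall>p. p tagged_division_of {a..b} \<and> \<gamma> fine p \<longrightarrow>
          norm ((\<Sum>(x, K)\<in>p. measure lborel K *\<^sub>R g0 x) - (f b - f a)) \<le> e * measure lborel {a..b})"
        using gauge error by (intro exI[of _ \<gamma>]) simp
    qed
  qed
  then show ?thesis
  proof (rule has_integral_spike[rotated 2])
    show "negligible S" using S by (simp only: negligible_iff_null_sets)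
    show "g t = g0 t" if "t \<in> {a..b} - S" for t using that by (simp add: g0_def)
  qed
qed

lemma abs_cont_on_Icc_vec_nth:
  fixes f :: "real \<Rightarrow> 'a::metric_space^'n"
  assumes "abs_cont_on_Icc f a b"
  shows "abs_cont_on_Icc (\<lambda>t. f t $ i) a b"
  unfolding abs_cont_on_Icc_def
proof (intro allI impI)
  fix e :: real
  assume "e > 0"
  then obtain \<delta> where "\<delta> > 0" and \<delta>: "\<forall>D. finite D \<longrightarrow>
      (\<forall>(c, d)\<in>D. a \<le> c \<and> c \<le> d \<and> d \<le> b) \<longrightarrow>
      disjoint_family_on (\<lambda>(c, d). {c<..<d}) D \<longrightarrow> (\<Sum>(c, d)\<in>D. d - c) < \<delta> \<longrightarrow>
      (\<Sum>(c, d)\<in>D. dist (f c) (f d)) < e"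
    using assms unfolding abs_cont_on_Icc_def by blast
  show "\<exists>\<delta>>0. \<forall>D. finite D \<longrightarrow> (\<forall>(c, d)\<in>D. a \<le> c \<and> c \<le> d \<and> d \<le> b) \<longrightarrow>
      disjoint_family_on (\<lambda>(c, d). {c<..<d}) D \<longrightarrow> (\<Sum>(c, d)\<in>D. d - c) < \<delta> \<longrightarrow>
      (\<Sum>(c, d)\<in>D. dist (f c $ i) (f d $ i)) < e"
  proof (intro exI[of _ \<delta>] conjI allI impI)
    fix D :: "(real \<times> real) set"
    assume D: "finite D" "\<forall>(c, d)\<in>D. a \<le> c \<and> c \<le> d \<and> d \<le> b"
      "disjoint_family_on (\<lambda>(c, d). {c<..<d}) D" "(\<Sum>(c, d)\<in>D. d - c) < \<delta>"
    have "(\<Sum>(c, d)\<in>D. dist (f c $ i) (f d $ i)) \<le> (\<Sum>(c, d)\<in>D. dist (f c) (f d))"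
      by (intro sum_mono) (auto simp: dist_vec_nth_le)
    also have "\<dots> < e"
      by (rule \<delta>[THEN spec, THEN mp, THEN mp, THEN mp, THEN mp]) (fact D)+
    finally show "(\<Sum>(c, d)\<in>D. dist (f c $ i) (f d $ i)) < e" .
  qed fact
qed

section \<open>A first-contact argument\<close>

text \<open>At the first time at which some \<open>h k\<close> reaches zero, it does so from below, so its derivative
  there cannot be negative.\<close>

lemma first_contact:
  fixes h h' :: "'i::finite \<Rightarrow> real \<Rightarrow> real"
  assumes deriv: "\<And>i t. t \<ge> a \<Longrightarrow> (h i has_real_derivative h' i t) (at t within {a..})"
    and start: "\<And>i. h i a < 0"
    and contact: "\<And>i t. \<lbrakk>t > a; h i t = 0; \<And>j. h j t \<le> 0\<rbrakk> \<Longrightarrow> h' i t < 0"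
    and "t \<ge> a"
  shows "h i t < 0"
proof (rule ccontr)
  assume "\<not> h i t < 0"
  have cont: "continuous_on {a..} (h j)" for j
    by (rule DERIV_continuous_on) (use deriv in auto)
  define E where "E = (\<Union>j. {s \<in> {a..}. h j s \<in> {0..}})"
  have "closed {s \<in> {a..}. h j s \<in> {0..}}" for j
    using continuous_closed_preimage[OF cont[of j] closed_atLeast closed_atLeast, of 0]
    by (simp add: Int_def vimage_def)
  then have "closed E"
    unfolding E_def by (intro closed_UN) auto
  moreover have "E \<noteq> {}" "bdd_below E"
    using \<open>\<not> h i t < 0\<close> \<open>t \<ge> a\<close> by (auto simp: E_def not_less intro!: bdd_belowI[of _ a])
  ultimately have "Inf E \<in> E"
    by (simp add: closed_contains_Inf)
  define s where "s = Inf E"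
  obtain k where "s \<ge> a" "h k s \<ge> 0"
    using \<open>Inf E \<in> E\<close> by (auto simp: E_def s_def)
  then have "s > a" using start[of k] by (cases "s = a") auto
  have before: "h j r < 0" if "a \<le> r" "r < s" for j r
  proof (rule ccontr)
    assume "\<not> h j r < 0"
    then have "0 \<le> h j r" by simp
    then have "r \<in> E" using that by (auto simp: E_def)
    then show False using cInf_lower[OF _ \<open>bdd_below E\<close>, of r] that by (simp add: s_def)
  qed
  have at_s: "h j s \<le> 0" for j
  proof (rule continuous_le_on_closure[of "{a..<s}" "h j" s 0])
    show "continuous_on (closure {a..<s}) (h j)"
      using \<open>s > a\<close> by (intro continuous_on_subset[OF cont]) auto
    show "s \<in> closure {a..<s}" using \<open>s > a\<close> by auto
    show "h j r \<le> 0" if "r \<in> {a..<s}" for r using before[of r j] that by auto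
  qed
  have "h k s = 0" using at_s[of k] \<open>h k s \<ge> 0\<close> by simp
  then have neg: "h' k s < 0" using contact[OF \<open>s > a\<close>] at_s by blast
  have "at s within {a..} = at s"
    using \<open>s > a\<close> by (intro at_within_interior) simp
  then have "(h k has_real_derivative h' k s) (at s)"
    using deriv[OF \<open>s \<ge> a\<close>, of k] by simp
  from DERIV_neg_dec_left[OF this neg]
  obtain d where d: "d > 0" "\<And>r. 0 < r \<Longrightarrow> r < d \<Longrightarrow> h k s < h k (s - r)"
    by auto
  define r where "r = min (d / 2) (s - a)"
  have "0 < r" "r < d" "r \<le> s - a" using d \<open>s > a\<close> by (auto simp: r_def)
  then show False using d(2)[of r] before[of "s - r" k] \<open>h k s = 0\<close> by simp
qed

section \<open>The width of the estimate\<close>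

text \<open>The two faces share the ranges of all coordinates other than \<open>i\<close>. In these an upper bound
  minus a lower bound is the interval length times \<open>\<bar>a $ j\<bar>\<close>, whatever the sign of \<open>a $ j\<close>. In the
  \<open>i\<close>-th coordinate the faces are degenerate, so the sign of \<open>a $ i\<close> survives. The hats clip
  negative widths to zero.\<close>

lemma natext_faces_diff:
  fixes a v w :: "real^'n"
  shows "natext_upper a (face_upper i v w) - natext_lower a (face_lower i v w) =
    a $ i * max 0 (w $ i - v $ i) + (\<Sum>j\<in>UNIV - {i}. \<bar>a $ j\<bar> * max 0 (w $ j - v $ j))"
proof -
  let ?l = "hat_lower v w" and ?u = "hat_upper v w"
  have gap: "?u $ j - ?l $ j = max 0 (w $ j - v $ j)" for j
    by (auto simp: hat_lower_def hat_upper_def max_def min_def field_simps)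
  have le: "?l $ j \<le> ?u $ j" for j
    using hat_lower_le_hat_upper[of v w] by (simp add: less_eq_vec_def)
  have "?l \<le> (\<chi> j. if j = i then ?l $ i else ?u $ j)" "(\<chi> j. if j = i then ?u $ i else ?l $ j) \<le> ?u"
    using le by (auto simp: less_eq_vec_def)
  then have "natext_upper a (face_upper i v w) - natext_lower a (face_lower i v w) =
    (\<Sum>j\<in>UNIV. if j = i then a $ j * (?u $ j - ?l $ j) else \<bar>a $ j\<bar> * (?u $ j - ?l $ j))"
    unfolding face_lower_eq_Icc face_upper_eq_Icc
    by (simp add: natext_Icc flip: sum_subtractf)
      (intro sum.cong, auto simp: algebra_simps)
  also have "\<dots> = a $ i * max 0 (w $ i - v $ i) + (\<Sum>j\<in>UNIV - {i}. \<bar>a $ j\<bar> * max 0 (w $ j - v $ j))"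
    unfolding gap by (subst sum.remove[of _ i]) auto
  finally show ?thesis .
qed

definition width_rate :: "real^'n^'n \<Rightarrow> real^'n \<Rightarrow> 'n \<Rightarrow> real" where
  "width_rate M \<delta> i = M $ i $ i * max 0 (\<delta> $ i) + (\<Sum>j\<in>UNIV - {i}. \<bar>M $ i $ j\<bar> * max 0 (\<delta> $ j))"

text \<open>The width satisfies its differential equation at every time, including \<open>t0\<close> with a one-sided
  derivative. The two bounds are integrated separately and then subtracted: \<open>y\<close> cancels in the
  integrand, which becomes a continuous function of time because it depends on the continuous
  width alone.\<close>

lemma no_constraints_width_deriv:
  fixes A :: "real^'n^'n" and C :: "real^'n^'m" and L :: "real^'m^'n"
  assumes est: "no_constraints_estimate A C L t0 X0 y xL xU" and "t \<ge> t0"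
  shows "((\<lambda>t. (xU t - xL t) $ i) has_real_derivative width_rate (A - L ** C) (xU t - xL t) i)
           (at t within {t0..})"
proof -
  define fL where "fL = (\<lambda>i t. fhat_lower A C L i (face_lower i (xL t) (xU t)) + (L *v y t) $ i)"
  define fU where "fU = (\<lambda>i t. fhat_upper A C L i (face_upper i (xL t) (xU t)) + (L *v y t) $ i)"
  define \<delta> where "\<delta> = (\<lambda>i t. (xU t - xL t) $ i)"
  define r where "r = (\<lambda>i t. width_rate (A - L ** C) (xU t - xL t) i)"
  have acL: "abs_cont_on_Icc (\<lambda>t. xL t $ i) t0 T" and acU: "abs_cont_on_Icc (\<lambda>t. xU t $ i) t0 T"
    if "T \<ge> t0" for i T
    using est that abs_cont_on_Icc_vec_nth
    unfolding no_constraints_estimate_def abs_cont_on_from_def by blast+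
  have aeL: "AE t\<in>{t0..} in lebesgue. ((\<lambda>s. xL s $ i) has_real_derivative fL i t) (at t within {t0..})"
    and aeU: "AE t\<in>{t0..} in lebesgue. ((\<lambda>s. xU s $ i) has_real_derivative fU i t) (at t within {t0..})"
    for i
    using est unfolding no_constraints_estimate_def fL_def fU_def by blast+
  have integral: "(r i has_integral (\<delta> i T - \<delta> i t0)) {t0..T}" if "T \<ge> t0" for i T
  proof -
    have restrict: "AE t\<in>{t0..T} in lebesgue. (f has_vector_derivative g t) (at t within {t0..T})"
      if "AE t\<in>{t0..} in lebesgue. (f has_real_derivative g t) (at t within {t0..})" for f g
      using that
      by eventually_elim
        (auto simp: has_real_derivative_iff_has_vector_derivative intro: has_vector_derivative_within_subset)
    have "(fU i has_integral (xU T $ i - xU t0 $ i)) {t0..T}"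
      "(fL i has_integral (xL T $ i - xL t0 $ i)) {t0..T}"
      using fundamental_theorem_of_calculus_abs_cont[OF acU[OF that] that restrict[OF aeU]]
        fundamental_theorem_of_calculus_abs_cont[OF acL[OF that] that restrict[OF aeL]] by auto
    then have "((\<lambda>t. fU i t - fL i t) has_integral
        ((xU T $ i - xU t0 $ i) - (xL T $ i - xL t0 $ i))) {t0..T}"
      by (rule has_integral_diff)
    moreover have "fU i t - fL i t = r i t" for t
      using natext_faces_diff[of "row i (A - L ** C)" i "xL t" "xU t"]
      by (simp add: fU_def fL_def r_def fhat_upper_def fhat_lower_def width_rate_def row_def)
    ultimately show ?thesis by (simp add: \<delta>_def algebra_simps)
  qed
  have eq: "\<delta> i s = \<delta> i t0 + integral {t0..s} (r i)" if "s \<ge> t0" for i s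
    using integral_unique[OF integral[OF that, of i]] by simp
  have cont\<delta>: "continuous_on {t0..T} (\<delta> i)" if "T \<ge> t0" for i T
  proof -
    have "continuous_on {t0..T} (\<lambda>s. \<delta> i t0 + integral {t0..s} (r i))"
      using integral[OF that]
      by (intro continuous_intros indefinite_integral_continuous_1) blast
    then show ?thesis by (rule continuous_on_eq) (auto simp: eq[symmetric])
  qed
  have contr: "continuous_on {t0..T} (r i)" if "T \<ge> t0" for i T
  proof -
    have "r i = (\<lambda>t. (A - L ** C) $ i $ i * max 0 (\<delta> i t)
        + (\<Sum>j\<in>UNIV - {i}. \<bar>(A - L ** C) $ i $ j\<bar> * max 0 (\<delta> j t)))"
      by (simp add: r_def \<delta>_def width_rate_def)
    then show ?thesis by (simp only:) (intro continuous_intros cont\<delta>[OF that])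
  qed
  have "((\<lambda>s. \<delta> i t0 + integral {t0..s} (r i)) has_real_derivative r i t) (at t within {t0..t + 1})"
    using integral_has_real_derivative[OF contr, of "t + 1" t i] \<open>t \<ge> t0\<close>
    by (auto intro!: derivative_eq_intros)
  then have "(\<delta> i has_real_derivative r i t) (at t within {t0..t + 1})"
    by (rule has_field_derivative_transform_within[OF _ zero_less_one])
      (use \<open>t \<ge> t0\<close> in \<open>auto simp: eq[symmetric]\<close>)
  also have "at t within {t0..t + 1} = at t within {t0..}"
    by (rule at_within_nhd[of _ "{..<t + 1}"]) auto
  finally show ?thesis by (simp add: \<delta>_def r_def)
qed

text \<open>Where a coordinate is negative its own term in the rate vanishes and the other terms are
  nonnegative, so it cannot decrease. To turn this weak inequality into the strict one needed for
  \<open>first_contact\<close>, the coordinate is compared with the strictly decreasing barrier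
  \<open>- e (1 + (t - t0))\<close>.\<close>

lemma width_ode_nonneg:
  fixes \<delta> :: "real \<Rightarrow> real^'n"
  assumes deriv: "\<And>i t. t \<ge> t0 \<Longrightarrow>
      ((\<lambda>t. \<delta> t $ i) has_real_derivative width_rate M (\<delta> t) i) (at t within {t0..})"
    and start: "\<And>i. \<delta> t0 $ i \<ge> 0" and "t \<ge> t0"
  shows "\<delta> t $ i \<ge> 0"
proof (rule ccontr)
  assume neg: "\<not> \<delta> t $ i \<ge> 0"
  (* The slope e is chosen so that the barrier is only half as deep as the supposed negative
     value at time t. *)
  define N where "N = 1 + (t - t0)"
  define e where "e = - \<delta> t $ i / (2 * N)"
  have "N > 0" using \<open>t \<ge> t0\<close> by (simp add: N_def)
  then have "e > 0" using neg by (simp add: e_def divide_neg_pos)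
  have "- \<delta> t $ i - e * (1 + (t - t0)) < 0"
  proof (rule first_contact[where a = t0 and h = "\<lambda>i t. - \<delta> t $ i - e * (1 + (t - t0))"
        and h' = "\<lambda>i t. - width_rate M (\<delta> t) i - e"])
    fix j s
    assume "s \<ge> t0"
    then show "((\<lambda>t. - \<delta> t $ j - e * (1 + (t - t0))) has_real_derivative
        - width_rate M (\<delta> s) j - e) (at s within {t0..})"
      by (auto intro!: derivative_eq_intros deriv)
  next
    fix j
    show "- \<delta> t0 $ j - e * (1 + (t0 - t0)) < 0" using start[of j] \<open>e > 0\<close> by simp
  next
    fix j s
    assume "s > t0" and "- \<delta> s $ j - e * (1 + (s - t0)) = 0"
    moreover have "e * (1 + (s - t0)) > 0" using \<open>e > 0\<close> \<open>s > t0\<close> by simp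
    ultimately have "\<delta> s $ j < 0" by linarith
    then have "width_rate M (\<delta> s) j \<ge> 0"
      by (auto simp: width_rate_def intro!: sum_nonneg)
    then show "- width_rate M (\<delta> s) j - e < 0" using \<open>e > 0\<close> by simp
  qed (fact \<open>t \<ge> t0\<close>)
  moreover have "e * N = - \<delta> t $ i / 2"
    using \<open>N > 0\<close> by (simp add: e_def)
  ultimately show False using neg by (simp add: N_def)
qed

text \<open>When a coordinate touches the barrier \<open>u = K exp (- c (t - t0))\<close> from below while the others
  do not exceed it, the rate is at most \<open>(M $ i $ i + (\<Sum>j\<noteq>i. \<bar>M $ i $ j\<bar>)) u < - c u = u'\<close>, so the
  coordinate is falling faster than the barrier.\<close>

lemma width_ode_exp_bound:
  fixes \<delta> :: "real \<Rightarrow> real^'n"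
  assumes deriv: "\<And>i t. t \<ge> t0 \<Longrightarrow>
      ((\<lambda>t. \<delta> t $ i) has_real_derivative width_rate M (\<delta> t) i) (at t within {t0..})"
    and dominant: "\<And>i. M $ i $ i + (\<Sum>j\<in>UNIV - {i}. \<bar>M $ i $ j\<bar>) < - c"
    and start: "\<And>i. \<delta> t0 $ i < K" and "K > 0" and "t \<ge> t0"
  shows "\<delta> t $ i < K * exp (- c * (t - t0))"
proof -
  define u where "u = (\<lambda>t. K * exp (- c * (t - t0)))"
  have u_pos: "u t > 0" for t using \<open>K > 0\<close> by (simp add: u_def)
  have "\<delta> t $ i - u t < 0"
  proof (rule first_contact[where a = t0 and h = "\<lambda>i t. \<delta> t $ i - u t"
        and h' = "\<lambda>i t. width_rate M (\<delta> t) i + c * u t"])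
    fix j s
    assume "s \<ge> t0"
    then show "((\<lambda>t. \<delta> t $ j - u t) has_real_derivative width_rate M (\<delta> s) j + c * u s)
        (at s within {t0..})"
      unfolding u_def by (auto intro!: derivative_eq_intros deriv)
  next
    fix j
    show "\<delta> t0 $ j - u t0 < 0" using start[of j] by (simp add: u_def)
  next
    fix j s
    assume eq: "\<delta> s $ j - u s = 0" and le: "\<And>k. \<delta> s $ k - u s \<le> 0"
    have max_eq: "max 0 (\<delta> s $ j) = u s" using eq u_pos[of s] by simp
    have "width_rate M (\<delta> s) j \<le> M $ j $ j * u s + (\<Sum>k\<in>UNIV - {j}. \<bar>M $ j $ k\<bar> * u s)"
      unfolding width_rate_def max_eq using le u_pos[of s]
      by (intro add_left_mono sum_mono mult_left_mono) (auto simp: less_imp_le)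
    also have "\<dots> = (M $ j $ j + (\<Sum>k\<in>UNIV - {j}. \<bar>M $ j $ k\<bar>)) * u s"
      by (simp add: sum_distrib_right distrib_right)
    also have "\<dots> < - c * u s"
      using dominant u_pos by (rule mult_strict_right_mono)
    finally show "width_rate M (\<delta> s) j + c * u s < 0" by simp
  qed (fact \<open>t \<ge> t0\<close>)
  then show ?thesis by (simp add: u_def)
qed

theorem theorem2:
  fixes A :: "real^'n^'n" and C :: "real^'n^'m" and L :: "real^'m^'n"
    and X0 :: "(real^'n) set" and t0 :: real
    and x xL xU :: "real \<Rightarrow> real^'n" and y :: "real \<Rightarrow> real^'m"
  assumes X0: "\<exists>a b. a \<le> b \<and> X0 = {a..b}"
    and sys: "lti_solution A C t0 X0 x y"
    and gain: "\<And>i. A $ i $ i - row i L \<bullet> column i C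
                 + (\<Sum>j\<in>UNIV - {i}. \<bar>A $ i $ j - row i L \<bullet> column j C\<bar>) < 0"
    and est: "no_constraints_estimate A C L t0 X0 y xL xU"
  shows "((\<lambda>t. xU t - xL t) \<longlongrightarrow> 0) at_top"
proof -
  define M where "M = A - L ** C"
  define \<delta> where "\<delta> = (\<lambda>t. xU t - xL t)"
  have deriv: "((\<lambda>t. \<delta> t $ i) has_real_derivative width_rate M (\<delta> t) i) (at t within {t0..})"
    if "t \<ge> t0" for i t
    using no_constraints_width_deriv[OF est that] by (simp add: \<delta>_def M_def)
  have "xL t0 \<le> xU t0"
    using X0 est unfolding no_constraints_estimate_def by (metis atLeastatMost_empty_iff)
  then have start_nonneg: "\<delta> t0 $ i \<ge> 0" for i
    by (simp add: \<delta>_def less_eq_vec_def)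
  have nonneg: "\<delta> t $ i \<ge> 0" if "t \<ge> t0" for t i
    using deriv start_nonneg that by (rule width_ode_nonneg)
  define R where "R = (\<lambda>i. M $ i $ i + (\<Sum>j\<in>UNIV - {i}. \<bar>M $ i $ j\<bar>))"
  have "M $ i $ j = A $ i $ j - row i L \<bullet> column j C" for i j
    by (simp add: M_def matrix_matrix_mult_def inner_vec_def row_def column_def)
  then have "R i < 0" for i using gain[of i] by (simp add: R_def)
  then have "Max (range R) < 0" by simp
  then obtain c where c: "Max (range R) < - c" "c > 0"
    using dense[of "Max (range R)" 0] by (metis minus_minus neg_0_less_iff_less)
  have dominant: "M $ i $ i + (\<Sum>j\<in>UNIV - {i}. \<bar>M $ i $ j\<bar>) < - c" for i
    using c(1) by (simp add: R_def)
  define K where "K = norm (\<delta> t0) + 1"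
  have "K > 0" by (simp add: K_def add_nonneg_pos)
  have start: "\<delta> t0 $ i < K" for i
    using component_le_norm_cart[of "\<delta> t0" i] by (simp add: K_def)
  have decay: "((\<lambda>t. K * exp (- c * (t - t0))) \<longlongrightarrow> 0) at_top"
  proof -
    have "filterlim (\<lambda>t. - t0 + t) at_top at_top"
      by (rule filterlim_tendsto_add_at_top[OF tendsto_const filterlim_ident])
    then have "filterlim (\<lambda>t. - c * (t - t0)) at_bot at_top"
      using c(2) by (intro filterlim_tendsto_neg_mult_at_bot[OF tendsto_const]) auto
    then show ?thesis
      by (intro tendsto_mult_right_zero filterlim_compose[OF exp_at_bot])
  qed
  have "((\<lambda>t. \<delta> t $ i) \<longlongrightarrow> 0) at_top" for i
  proof (rule tendsto_sandwich[OF _ _ tendsto_const decay])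
    show "\<forall>\<^sub>F t in at_top. 0 \<le> \<delta> t $ i"
      using eventually_ge_at_top[of t0] by eventually_elim (rule nonneg)
    show "\<forall>\<^sub>F t in at_top. \<delta> t $ i \<le> K * exp (- c * (t - t0))"
      using eventually_ge_at_top[of t0]
    proof eventually_elim
      case (elim t)
      then show ?case
        using width_ode_exp_bound[OF deriv dominant start \<open>K > 0\<close>, of t i] by simp
    qed
  qed
  then have "(\<delta> \<longlongrightarrow> 0) at_top" by (intro vec_tendstoI) simp
  then show ?thesis by (simp add: \<delta>_def)
qed

end
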